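(* Let $c\in\mathbb C^4$ and suppose that there is a partition $\{i_1,i_2\}\cup\{i_3,i_4\}=\{1,2,3,4\}$ such that $|c_{i_1}|=|c_{i_2}|=r$ and $|c_{i_3}|=|c_{i_4}|=s$ with $r,s\ne 0$. If $\phi_c\neq 0$ (mod $2\pi$), then $$\|c\|_{\mathsf X}'=\sqrt{\frac{r^2t_0^2+2rst_0|\sin(\phi_c/2)|+s^2}{t_0^2+1}},\qquad\text{where}\quad t_0=\frac{r^2-s^2+\sqrt{(r^2-s^2)^2+(2rs\sin(\phi_c/2))^2}}{2rs|\sin(\phi_c/2)|}.$$ If $\phi_c=0$ (mod $2\pi$), then $\|c\|_{\mathsf X}'=\max\{r,s\}$.
   Context: On $\mathbb C^4$ define the norm $\|z\|_{\mathsf X}=\max_{\sigma\in\mathbb R}\left(|z_1e^{\mathrm i\sigma}+\bar z_4|+|z_2e^{\mathrm i\sigma}+\bar z_3|\right)$ and its dual norm $\|c\|_{\mathsf X}'=\max\{|\langle c,z\rangle|:\|z\|_{\mathsf X}=1\}$, where $\langle c,z\rangle=\sum_{i=1}^4c_iz_i$ (bilinear). Writing $c_j=|c_j|e^{\mathrm i\theta_j}$, the phase difference of $c$ is $\phi_c=(\theta_1+\theta_4)-(\theta_2+\theta_3)$ mod $2\pi$. *)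

theory Defs
  imports "HOL-Analysis.Analysis" "HOL-Library.Real_Mod"
begin

text \<open>Both maxima below are written as suprema in \<^typ>\<open>real\<close>, where an unbounded supremum is
  unspecified; \<open>X_norm_attained\<close> and \<open>X_dual_norm_attained\<close> show that they are maxima.\<close>

definition X_profile :: "complex ^ 4 \<Rightarrow> real \<Rightarrow> real" where
  "X_profile z \<sigma> = cmod (z $ 1 * exp (\<i> * complex_of_real \<sigma>) + cnj (z $ 4))
                 + cmod (z $ 2 * exp (\<i> * complex_of_real \<sigma>) + cnj (z $ 3))"

definition X_norm :: "complex ^ 4 \<Rightarrow> real" where
  "X_norm z = (SUP \<sigma>. X_profile z \<sigma>)"

definition bilin :: "complex ^ 4 \<Rightarrow> complex ^ 4 \<Rightarrow> complex" where
  "bilin c z = (\<Sum>i\<in>UNIV. c $ i * z $ i)"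

definition X_dual_norm :: "complex ^ 4 \<Rightarrow> real" where
  "X_dual_norm c = Sup {cmod (bilin c z) | z. X_norm z = 1}"

text \<open>The phase difference is only determined modulo \<open>2 * pi\<close>, so it is a relation: \<open>\<phi>\<close> is a
  real representative of it, obtained from some choice of arguments of the coordinates.\<close>

definition is_phase_difference :: "complex ^ 4 \<Rightarrow> real \<Rightarrow> bool" where
  "is_phase_difference c \<phi> \<longleftrightarrow>
     (\<exists>\<theta> :: real ^ 4.
        (\<forall>j. c $ j = complex_of_real (cmod (c $ j)) * exp (\<i> * complex_of_real (\<theta> $ j))) \<and>
        \<phi> = (\<theta> $ 1 + \<theta> $ 4) - (\<theta> $ 2 + \<theta> $ 3))"

lemma X_profile_cis:
  "X_profile z \<sigma> = cmod (z $ 1 * cis \<sigma> + cnj (z $ 4)) + cmod (z $ 2 * cis \<sigma> + cnj (z $ 3))"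
  by (simp add: X_profile_def cis_conv_exp)

lemma X_profile_periodic: "\<exists>\<tau>\<in>{0..2*pi}. X_profile z \<sigma> = X_profile z \<tau>"
proof
  have "cis (\<sigma> rmod (2 * pi)) = cis \<sigma>"
    by (simp add: cis_eq_iff)
  then show "X_profile z \<sigma> = X_profile z (\<sigma> rmod (2 * pi))"
    by (simp add: X_profile_cis)
  show "\<sigma> rmod (2 * pi) \<in> {0..2*pi}"
    using rmod_nonneg[of "2*pi" \<sigma>] rmod_less[of "2*pi" \<sigma>] by simp
qed

lemma X_norm_attained:
  "\<exists>\<sigma>. X_norm z = X_profile z \<sigma> \<and> (\<forall>\<tau>. X_profile z \<tau> \<le> X_profile z \<sigma>)"
proof -
  have "continuous_on {0..2*pi} (X_profile z)"
    unfolding X_profile_def by (intro continuous_intros)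
  then obtain \<sigma> where \<sigma>: "\<And>\<tau>. \<tau> \<in> {0..2*pi} \<Longrightarrow> X_profile z \<tau> \<le> X_profile z \<sigma>"
    using continuous_attains_sup[of "{0..2*pi}" "X_profile z"] pi_gt_zero
    by (metis atLeastAtMost_iff compact_Icc empty_iff less_eq_real_def mult_pos_pos zero_less_numeral)
  then have *: "\<forall>\<tau>. X_profile z \<tau> \<le> X_profile z \<sigma>"
    using X_profile_periodic by metis
  then have "X_norm z = X_profile z \<sigma>"
    unfolding X_norm_def by (intro cSup_eq_maximum) auto
  with * show ?thesis by blast
qed

lemma X_profile_le: "X_profile z \<sigma> \<le> X_norm z"
  using X_norm_attained by metis

lemma component_le_X_norm: "cmod (z $ j) \<le> X_norm z"
proof -
  have *: "cmod a \<le> M \<and> cmod b \<le> M"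
    if "cmod (a + b) \<le> M" "cmod (- a + b) \<le> M" for a b M
    using norm_triangle_ineq4[of "a + b" "- a + b"] norm_triangle_ineq[of "a + b" "- a + b"] that
    by (simp flip: mult_2)
  have "X_profile z 0 = cmod (z $ 1 + cnj (z $ 4)) + cmod (z $ 2 + cnj (z $ 3))"
    "X_profile z pi = cmod (- z $ 1 + cnj (z $ 4)) + cmod (- z $ 2 + cnj (z $ 3))"
    by (simp_all add: X_profile_cis)
  then have le: "cmod (z $ 1 + cnj (z $ 4)) + cmod (z $ 2 + cnj (z $ 3)) \<le> X_norm z"
    "cmod (- z $ 1 + cnj (z $ 4)) + cmod (- z $ 2 + cnj (z $ 3)) \<le> X_norm z"
    using X_profile_le[of z 0] X_profile_le[of z pi] by linarith+
  have "cmod (z $ 1 + cnj (z $ 4)) \<le> X_norm z" "cmod (- z $ 1 + cnj (z $ 4)) \<le> X_norm z"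
    "cmod (z $ 2 + cnj (z $ 3)) \<le> X_norm z" "cmod (- z $ 2 + cnj (z $ 3)) \<le> X_norm z"
    using le norm_ge_zero[of "z $ 1 + cnj (z $ 4)"] norm_ge_zero[of "- z $ 1 + cnj (z $ 4)"]
      norm_ge_zero[of "z $ 2 + cnj (z $ 3)"] norm_ge_zero[of "- z $ 2 + cnj (z $ 3)"]
    by linarith+
  then have "cmod (z $ 1) \<le> X_norm z \<and> cmod (cnj (z $ 4)) \<le> X_norm z"
    "cmod (z $ 2) \<le> X_norm z \<and> cmod (cnj (z $ 3)) \<le> X_norm z"
    using * by blast+
  then show ?thesis
    using exhaust_4[of j] by auto
qed

lemma X_profile_diff: "X_profile z \<sigma> \<le> X_profile w \<sigma> + 4 * norm (z - w)"
proof -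
  have n: "cmod (z $ j - w $ j) \<le> norm (z - w)" for j
    using Finite_Cartesian_Product.norm_nth_le[of "z - w" j] by simp
  have *: "cmod (a * cis \<sigma> + cnj b) \<le> cmod (a' * cis \<sigma> + cnj b') + cmod (a - a') + cmod (b - b')"
    for a b a' b'
  proof -
    have "a * cis \<sigma> + cnj b = (a' * cis \<sigma> + cnj b') + (a - a') * cis \<sigma> + cnj (b - b')"
      by (simp add: algebra_simps)
    then have "cmod (a * cis \<sigma> + cnj b)
        \<le> cmod (a' * cis \<sigma> + cnj b') + cmod ((a - a') * cis \<sigma>) + cmod (cnj (b - b'))"
      by (simp only: norm_triangle_mono norm_triangle_ineq order_refl)
    then show ?thesis by (simp only: norm_mult norm_cis complex_mod_cnj mult_1_right)
  qed
  show ?thesis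
    using *[of "z $ 1" "z $ 4" "w $ 1" "w $ 4"] *[of "z $ 2" "z $ 3" "w $ 2" "w $ 3"]
      n[of 1] n[of 2] n[of 3] n[of 4]
    unfolding X_profile_cis by linarith
qed

lemma X_norm_diff: "X_norm z \<le> X_norm w + 4 * norm (z - w)"
proof -
  obtain \<sigma> where "X_norm z = X_profile z \<sigma>"
    using X_norm_attained by blast
  then show ?thesis
    using X_profile_diff[of z \<sigma> w] X_profile_le[of w \<sigma>] by linarith
qed

lemma continuous_on_X_norm: "continuous_on UNIV X_norm"
proof -
  have "dist (X_norm z) (X_norm w) \<le> 4 * dist z w" for z w
    using X_norm_diff[of z w] X_norm_diff[of w z]
    by (simp add: dist_norm norm_minus_commute abs_le_iff)
  then have "4-lipschitz_on UNIV X_norm"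
    by (intro lipschitz_onI) auto
  then show ?thesis by (rule lipschitz_on_continuous_on)
qed

lemma compact_X_sphere: "compact {z. X_norm z = 1}"
proof -
  have "closed {z. X_norm z = 1}"
    by (rule closed_Collect_eq[OF continuous_on_X_norm continuous_on_const])
  moreover have "norm z \<le> 4" if "X_norm z = 1" for z
  proof -
    have "norm z \<le> (\<Sum>i\<in>UNIV. cmod (z $ i))"
      unfolding norm_vec_def by (rule L2_set_le_sum) simp
    also have "\<dots> \<le> of_nat CARD(4) * X_norm z"
      by (rule sum_bounded_above) (rule component_le_X_norm)
    finally show ?thesis using that by simp
  qed
  ultimately show ?thesis
    by (auto simp: compact_eq_bounded_closed bounded_iff)
qed

lemma X_sphere_nonempty: "{z. X_norm z = 1} \<noteq> {}"
proof -
  have "X_norm (axis 1 1) = 1"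
    by (simp add: X_norm_def X_profile_def axis_def norm_mult)
  then show ?thesis by blast
qed

lemma X_dual_norm_attained:
  "\<exists>z. X_norm z = 1 \<and> X_dual_norm c = cmod (bilin c z) \<and>
       (\<forall>w. X_norm w = 1 \<longrightarrow> cmod (bilin c w) \<le> cmod (bilin c z))"
proof -
  have "continuous_on {z. X_norm z = 1} (\<lambda>z. cmod (bilin c z))"
    unfolding bilin_def by (intro continuous_intros)
  then obtain z where z: "X_norm z = 1"
      "\<And>w. X_norm w = 1 \<Longrightarrow> cmod (bilin c w) \<le> cmod (bilin c z)"
    using continuous_attains_sup[OF compact_X_sphere X_sphere_nonempty] by fastforce
  moreover from z have "X_dual_norm c = cmod (bilin c z)"
    unfolding X_dual_norm_def by (intro cSup_eq_maximum) auto
  ultimately show ?thesis by blast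
qed

end

theory Submission
  imports Defs
begin

text \<open>Let \<open>U\<close> be the set of \<open>u\<close> with unimodular coordinates and \<open>u\<^sub>1 u\<^sub>4 = u\<^sub>2 u\<^sub>3\<close>. Linearizing
  both absolute values gives \<open>\<parallel>z\<parallel>\<^sub>X = max {Re \<langle>u, z\<rangle> | u \<in> U}\<close>, so a decomposition
  \<open>c = A u + B v\<close> with \<open>u, v \<in> U\<close> and \<open>A, B \<ge> 0\<close> yields \<open>\<parallel>c\<parallel>\<^sub>X' \<le> A + B\<close>. Up to a phase twist by
  an element of \<open>U\<close>, the vector \<open>c\<close> is \<open>(x, y, y, x)\<close>, \<open>(x, cnj x, y, cnj y)\<close> or
  \<open>(x, y, cnj x, cnj y)\<close>, with \<open>\<bar>x\<bar>\<close> and \<open>\<bar>y\<bar>\<close> the two moduli and \<open>\<phi>/2\<close> the angle between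
  \<open>x\<close> and \<open>y\<close>. The polar forms of \<open>(x + y)/2\<close> and \<open>(x - y)/2\<close> provide
  such a decomposition with \<open>u, v\<close> orthogonal, and \<open>z = cnj (u + v) / 4\<close> has norm at most 1 and
  satisfies \<open>\<langle>c, z\<rangle> = A + B\<close>. Finally, \<open>(A + B)\<^sup>2\<close> is the largest eigenvalue of
  the matrix \<open>((r\<^sup>2, rsk), (rsk, s\<^sup>2))\<close> with \<open>k = \<bar>sin (\<phi>/2)\<bar>\<close>, and \<open>(t\<^sub>0, 1)\<close> is an eigenvector.\<close>

section \<open>Phase vectors and their pairing with the norm\<close>

definition balanced_phases :: "complex ^ 4 \<Rightarrow> bool" where
  "balanced_phases u \<longleftrightarrow> (\<forall>j. cmod (u $ j) = 1) \<and> u $ 1 * u $ 4 = u $ 2 * u $ 3"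

lemma unimodular_mult_cnj:
  assumes "cmod u = 1"
  shows "u * cnj u = 1" "u * (cnj u * z) = z"
proof -
  show "u * cnj u = 1"
    using assms by (simp add: complex_norm_square[symmetric])
  then show "u * (cnj u * z) = z"
    by (simp flip: mult.assoc)
qed

lemma unimodular_conv_cis:
  assumes "cmod u = 1"
  obtains \<sigma> where "u = cis \<sigma>"
proof
  show "u = cis (Arg u)"
    using assms cis_Arg[of u] by (cases "u = 0") (auto simp: sgn_eq)
qed

text \<open>Rotating by \<open>u $ 4\<close> (resp. \<open>u $ 3\<close>) bounds each pair of terms
  by one absolute value in \<open>X_profile z \<sigma>\<close>, where
  \<open>cis \<sigma> = u $ 1 * u $ 4\<close>; balance lets the same \<open>\<sigma>\<close> serve
  both pairs.\<close>

lemma Re_bilin_le_X_norm: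
  assumes "balanced_phases u"
  shows "Re (bilin u z) \<le> X_norm z"
proof -
  have eq: "u $ 1 * u $ 4 = u $ 2 * u $ 3" and u: "cmod (u $ j) = 1" for j
    using assms by (auto simp: balanced_phases_def)
  have "cmod (u $ 1 * u $ 4) = 1" by (simp add: norm_mult u)
  then obtain \<sigma> where \<sigma>: "u $ 1 * u $ 4 = cis \<sigma>" by (rule unimodular_conv_cis)
  have *: "Re (a * z) + Re (b * w) \<le> cmod (z * (a * b) + cnj w)"
    if b: "cmod b = 1" for a b z w
  proof -
    have "z * (a * b) + cnj w = b * (a * z + cnj (b * w))"
      by (simp add: algebra_simps unimodular_mult_cnj[OF b])
    then have "cmod (z * (a * b) + cnj w) = cmod (a * z + cnj (b * w))"
      by (simp only: norm_mult b mult_1)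
    moreover have "Re (a * z + cnj (b * w)) = Re (a * z) + Re (b * w)" by simp
    ultimately show ?thesis using complex_Re_le_cmod by metis
  qed
  have "Re (bilin u z) = (Re (u $ 1 * z $ 1) + Re (u $ 4 * z $ 4))
      + (Re (u $ 2 * z $ 2) + Re (u $ 3 * z $ 3))"
    unfolding bilin_def sum_4 by simp
  also have "\<dots> \<le> X_profile z \<sigma>"
    unfolding X_profile_cis using *[OF u, of "u $ 1" "z $ 1" 4 "z $ 4"]
      *[OF u, of "u $ 2" "z $ 2" 3 "z $ 3"] \<sigma> eq by simp
  also have "\<dots> \<le> X_norm z" by (rule X_profile_le)
  finally show ?thesis .
qed

lemma cmod_bilin_le_X_norm:
  assumes "balanced_phases u"
  shows "cmod (bilin u z) \<le> X_norm z"
proof (cases "bilin u z = 0")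
  case True
  then show ?thesis using Re_bilin_le_X_norm[OF assms, of z] by simp
next
  case False
  \<comment> \<open>Balance survives a common unimodular factor, so the pairing can be rotated onto
    the nonnegative reals.\<close>
  define \<omega> where "\<omega> = cnj (sgn (bilin u z))"
  have \<omega>: "cmod \<omega> = 1" using False by (simp add: \<omega>_def norm_sgn)
  have "balanced_phases (\<omega> *s u)"
    using assms \<omega> by (simp add: balanced_phases_def norm_mult mult_ac)
  then have "Re (bilin (\<omega> *s u) z) \<le> X_norm z" by (rule Re_bilin_le_X_norm)
  moreover have "bilin (\<omega> *s u) z = \<omega> * bilin u z"
    by (simp add: bilin_def sum_distrib_left mult.assoc)
  moreover have "\<omega> * bilin u z = cmod (bilin u z)"
    using False by (simp add: \<omega>_def sgn_eq mult.commute complex_norm_square[symmetric]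
        field_simps power2_eq_square)
  ultimately show ?thesis by simp
qed

section \<open>The dual norm from a decomposition into two phase vectors\<close>

text \<open>Rescaling carries the bound from the unit sphere to the unit ball, since the later
  witness is only shown to have norm at most 1.\<close>

lemma cmod_bilin_le_X_dual_norm:
  assumes "X_norm z \<le> 1"
  shows "cmod (bilin c z) \<le> X_dual_norm c"
proof (cases "X_norm z \<le> 0")
  case True
  then have "z = 0"
    using component_le_X_norm[of z] by (simp add: vec_eq_iff) (meson norm_le_zero_iff order_trans)
  moreover have "0 \<le> X_dual_norm c"
    using X_dual_norm_attained[of c] by auto
  ultimately show ?thesis by (simp add: bilin_def)
next
  case False
  define m where "m = X_norm z"
  define w where "w = complex_of_real (inverse m) *s z"
  have m: "0 < m" "m \<le> 1" using False assms by (auto simp: m_def)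
  have "X_profile w \<sigma> = inverse m * X_profile z \<sigma>" for \<sigma>
  proof -
    have *: "w $ j * cis \<sigma> + cnj (w $ k) = complex_of_real (inverse m) * (z $ j * cis \<sigma> + cnj (z $ k))" for j k
      by (simp add: w_def algebra_simps)
    show ?thesis
      unfolding X_profile_cis * norm_mult norm_of_real using m by (simp add: distrib_left)
  qed
  then have "X_norm w = 1"
    using X_norm_attained[of w] X_norm_attained[of z] m
    by (smt (verit) left_inverse m_def mult_le_cancel_left_pos positive_imp_inverse_positive)
  then have "cmod (bilin c w) \<le> X_dual_norm c"
    using X_dual_norm_attained[of c] by metis
  moreover have "z = complex_of_real m *s w"
    using m by (simp add: w_def)
  then have "bilin c z = complex_of_real m * bilin c w"
    by (simp add: bilin_def sum_distrib_left mult.left_commute)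
  then have "cmod (bilin c z) = m * cmod (bilin c w)"
    using m by (simp add: norm_mult)
  then have "cmod (bilin c z) \<le> cmod (bilin c w)"
    using m by (simp add: mult_left_le_one_le)
  ultimately show ?thesis by simp
qed

text \<open>Here \<open>v = u w\<close> (coordinatewise), \<open>sum0\<close> is the orthogonality of \<open>u\<close> and \<open>v\<close>, and \<open>le4\<close> bounds
  the norm of the witness for \<open>u = (1, 1, 1, 1)\<close>: a general \<open>u\<close> only shifts \<open>\<sigma>\<close>.\<close>

lemma X_dual_norm_eqI:
  assumes u: "balanced_phases u" and w: "balanced_phases w"
    and sum0: "w $ 1 + w $ 2 + w $ 3 + w $ 4 = 0"
    and le4: "\<And>s. cmod s = 1 \<Longrightarrow>
        cmod ((1 + cnj (w $ 1)) * s + (1 + w $ 4)) + cmod ((1 + cnj (w $ 2)) * s + (1 + w $ 3)) \<le> 4"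
    and c: "\<And>j. c $ j = u $ j * (complex_of_real A + complex_of_real B * w $ j)"
    and AB: "A \<ge> 0" "B \<ge> 0"
  shows "X_dual_norm c = A + B"
proof (rule antisym)
  define v where "v = (\<chi> j. u $ j * w $ j)"
  \<comment> \<open>Multiplying the balance equations of \<open>u\<close> and \<open>w\<close> gives
    that of \<open>v\<close>.\<close>
  have v: "balanced_phases v"
    using u w arg_cong2[of "u $ 1 * u $ 4" "u $ 2 * u $ 3" "w $ 1 * w $ 4" "w $ 2 * w $ 3" times]
    by (simp add: balanced_phases_def v_def norm_mult mult_ac)
  obtain z where z: "X_norm z = 1" "X_dual_norm c = cmod (bilin c z)"
    using X_dual_norm_attained by metis
  have "bilin c z = complex_of_real A * bilin u z + complex_of_real B * bilin v z"
    by (simp add: bilin_def c v_def algebra_simps sum.distrib sum_distrib_left)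
  then have "cmod (bilin c z) \<le> A * cmod (bilin u z) + B * cmod (bilin v z)"
    using AB norm_triangle_ineq[of "complex_of_real A * bilin u z" "complex_of_real B * bilin v z"]
    by (simp add: norm_mult)
  also have "\<dots> \<le> A + B"
    using cmod_bilin_le_X_norm[OF u, of z] cmod_bilin_le_X_norm[OF v, of z] z(1) AB
    by (intro add_mono) (simp_all add: mult_left_le)
  finally show "X_dual_norm c \<le> A + B" using z by simp
next
  have ueq: "u $ 1 * u $ 4 = u $ 2 * u $ 3"
    and u1: "cmod (u $ j) = 1" and w1: "cmod (w $ j) = 1" for j
    using u w by (auto simp: balanced_phases_def)
  define z where "z = (\<chi> j. cnj (u $ j) * (1 + cnj (w $ j)) / 4)"
  have profile: "X_profile z \<sigma> \<le> 1" for \<sigma>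
  proof -
    define s where "s = cnj (u $ 1 * u $ 4) * cis \<sigma>"
    have s: "cmod s = 1" by (simp add: s_def norm_mult u1)
    have *: "cmod (z $ j * cis \<sigma> + cnj (z $ k)) = cmod ((1 + cnj (w $ j)) * s + (1 + w $ k)) / 4"
      if "s = cnj (u $ j * u $ k) * cis \<sigma>" for j k
    proof -
      have "z $ j * cis \<sigma> + cnj (z $ k) = u $ k * (((1 + cnj (w $ j)) * s + (1 + w $ k)) / 4)"
        using that unimodular_mult_cnj(1)[OF u1, of k] by (simp add: z_def field_simps) algebra
      then show ?thesis by (simp only: norm_mult norm_divide u1 mult_1 norm_numeral)
    qed
    show ?thesis
      using le4[OF s] *[of 1 4] *[of 2 3] ueq by (simp add: X_profile_cis s_def)
  qed
  then have "X_norm z \<le> 1" using X_norm_attained[of z] by metis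
  then have "cmod (bilin c z) \<le> X_dual_norm c" by (rule cmod_bilin_le_X_dual_norm)
  moreover have "bilin c z = complex_of_real (A + B)"
  proof -
    have *: "c $ j * z $ j = (A + B + (A * cnj (w $ j) + B * w $ j)) / 4" for j
    proof -
      have "c $ j * z $ j = (u $ j * cnj (u $ j)) * ((A + B * w $ j) * (1 + cnj (w $ j))) / 4"
        by (simp add: c z_def)
      also have "\<dots> = (A + B * (w $ j * cnj (w $ j)) + (A * cnj (w $ j) + B * w $ j)) / 4"
        by (simp add: unimodular_mult_cnj[OF u1] algebra_simps)
      finally show ?thesis by (simp add: unimodular_mult_cnj[OF w1])
    qed
    \<comment> \<open>The cross terms collect into multiples of the sum of the \<open>w $ j\<close>
      and of its conjugate, which \<open>sum0\<close> removes.\<close>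
    have "bilin c z = A + B + (A * cnj (w $ 1 + w $ 2 + w $ 3 + w $ 4)
        + B * (w $ 1 + w $ 2 + w $ 3 + w $ 4)) / 4"
      unfolding bilin_def sum_4 * by (simp add: field_simps)
    then show ?thesis by (simp add: sum0)
  qed
  ultimately show "A + B \<le> X_dual_norm c" using AB by (simp del: of_real_add)
qed

section \<open>Norm bounds for the two shapes of witness\<close>

text \<open>Serves \<open>w = (\<kappa>, -\<kappa>, -\<kappa>, \<kappa>)\<close>. Factoring out a
  square root of \<open>s\<close> leaves the reals \<open>2 * p + 2 * q\<close> and
  \<open>2 * p - 2 * q\<close>, whose absolute values add up to
  \<open>4 * max \<bar>p\<bar> \<bar>q\<bar>\<close>.\<close>

lemma cmod_add_cmod_le_4_of_real_pair:
  assumes "cmod s = 1" "cmod \<kappa> = 1"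
  shows "cmod ((1 + cnj \<kappa>) * s + (1 + \<kappa>)) + cmod ((1 - cnj \<kappa>) * s + (1 - \<kappa>)) \<le> 4"
proof -
  define h where "h = csqrt s"
  have hs: "h * h = s" by (simp add: h_def flip: power2_eq_square)
  have h: "cmod h = 1" using assms by (simp add: h_def)
  define p q where "p = Re h" and "q = Re (cnj \<kappa> * h)"
  have "h + cnj h = complex_of_real (2 * p)"
    unfolding p_def by (rule complex_add_cnj)
  moreover have "cnj \<kappa> * h + \<kappa> * cnj h = complex_of_real (2 * q)"
    using complex_add_cnj[of "cnj \<kappa> * h"] by (simp add: q_def)
  moreover have "(1 + cnj \<kappa>) * s + (1 + \<kappa>) = h * ((h + cnj h) + (cnj \<kappa> * h + \<kappa> * cnj h))"
    "(1 - cnj \<kappa>) * s + (1 - \<kappa>) = h * ((h + cnj h) - (cnj \<kappa> * h + \<kappa> * cnj h))"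
    using hs unimodular_mult_cnj[OF h] by (simp_all add: algebra_simps)
  ultimately have eq: "(1 + cnj \<kappa>) * s + (1 + \<kappa>) = h * complex_of_real (2 * p + 2 * q)"
    "(1 - cnj \<kappa>) * s + (1 - \<kappa>) = h * complex_of_real (2 * p - 2 * q)"
    by simp_all
  have "\<bar>p\<bar> \<le> 1" "\<bar>q\<bar> \<le> 1"
    using abs_Re_le_cmod[of h] abs_Re_le_cmod[of "cnj \<kappa> * h"] h assms
    by (simp_all add: p_def q_def norm_mult)
  then show ?thesis
    unfolding eq norm_mult h norm_of_real mult_1 by arith
qed

text \<open>Serves \<open>w = (\<kappa>, cnj \<kappa>, -\<kappa>, -cnj \<kappa>)\<close>. The cross
  terms of the two squared moduli are opposite, so the squares add up to 8, and
  \<open>(x + y)^2 \<le> 2 * (x^2 + y^2)\<close>.\<close>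

lemma cmod_add_cmod_le_4_of_conjugate_pair:
  assumes "cmod s = 1" "cmod \<kappa> = 1"
  shows "cmod ((1 + cnj \<kappa>) * s + (1 - cnj \<kappa>)) + cmod ((1 + \<kappa>) * s + (1 - \<kappa>)) \<le> 4"
    (is "cmod ?a + cmod ?b \<le> 4")
proof -
  have 1: "(Re s)\<^sup>2 + (Im s)\<^sup>2 = 1" "(Re \<kappa>)\<^sup>2 + (Im \<kappa>)\<^sup>2 = 1"
    using assms by (simp_all flip: cmod_power2)
  have "(cmod ?a)\<^sup>2 + (cmod ?b)\<^sup>2 = 8"
    unfolding cmod_power2 using 1 by simp algebra
  then have "(cmod ?a + cmod ?b)\<^sup>2 \<le> 4\<^sup>2"
    using sum_squares_bound[of "cmod ?a" "cmod ?b"] by (simp add: power2_sum)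
  then show ?thesis by (rule power2_le_imp_le) simp
qed

section \<open>Closed form of the sum of the two coefficients\<close>

text \<open>Square root of the larger eigenvalue of the matrix above with
  \<open>k = \<bar>sin \<psi>\<bar>\<close>. Unlike the expression in \<open>t\<^sub>0\<close>, it
  is visibly symmetric in \<open>r\<close> and \<open>s\<close> and does not divide by the
  sine.\<close>

definition dual_value :: "real \<Rightarrow> real \<Rightarrow> real \<Rightarrow> real" where
  "dual_value r s \<psi> =
     sqrt ((r\<^sup>2 + s\<^sup>2 + sqrt ((r\<^sup>2 - s\<^sup>2)\<^sup>2 + (2 * r * s * sin \<psi>)\<^sup>2)) / 2)"

lemma dual_value_commute: "dual_value r s \<psi> = dual_value s r \<psi>"
  by (simp add: dual_value_def power2_commute[of "r\<^sup>2"] mult_ac add.commute)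

text \<open>In the square of the left side, the parallelogram law gives the two squares, and the
  mixed product is the modulus of \<open>x^2 - y^2\<close>.\<close>

lemma half_sum_diff_norms:
  "(cmod (rcis r \<alpha> + rcis s \<beta>) + cmod (rcis r \<alpha> - rcis s \<beta>)) / 2 = dual_value r s (\<alpha> - \<beta>)"
proof -
  define x y where "x = rcis r \<alpha>" and "y = rcis s \<beta>"
  have cs: "(cos \<alpha>)\<^sup>2 + (sin \<alpha>)\<^sup>2 = 1" "(cos \<beta>)\<^sup>2 + (sin \<beta>)\<^sup>2 = 1" by simp_all
  have parallelogram: "(cmod (x + y))\<^sup>2 + (cmod (x - y))\<^sup>2 = 2 * (r\<^sup>2 + s\<^sup>2)"
    unfolding cmod_power2 x_def y_def by simp (use cs in algebra)
  have "(cmod (x + y) * cmod (x - y))\<^sup>2 = (r\<^sup>2 - s\<^sup>2)\<^sup>2 + (2 * r * s * sin (\<alpha> - \<beta>))\<^sup>2"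
    unfolding power_mult_distrib cmod_power2 x_def y_def sin_diff by simp (use cs in algebra)
  then have "cmod (x + y) * cmod (x - y) = sqrt ((r\<^sup>2 - s\<^sup>2)\<^sup>2 + (2 * r * s * sin (\<alpha> - \<beta>))\<^sup>2)"
    by (metis norm_ge_zero mult_nonneg_nonneg real_sqrt_unique)
  with parallelogram have "((cmod (x + y) + cmod (x - y)) / 2)\<^sup>2
      = (r\<^sup>2 + s\<^sup>2 + sqrt ((r\<^sup>2 - s\<^sup>2)\<^sup>2 + (2 * r * s * sin (\<alpha> - \<beta>))\<^sup>2)) / 2"
    by (simp add: power_divide power2_sum)
  then show ?thesis
    unfolding dual_value_def x_def y_def by (metis add_nonneg_nonneg divide_nonneg_nonneg
        norm_ge_zero real_sqrt_unique zero_le_numeral)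
qed

lemma rcis_pair_decomposition:
  obtains A B :: real and a \<kappa> :: complex
  where "A \<ge> 0" "B \<ge> 0" "cmod a = 1" "cmod \<kappa> = 1"
    "rcis r \<alpha> = a * (A + B * \<kappa>)" "rcis s \<beta> = a * (A - B * \<kappa>)"
    "A + B = dual_value r s (\<alpha> - \<beta>)"
proof -
  define P Q where "P = (rcis r \<alpha> + rcis s \<beta>) / 2" and "Q = (rcis r \<alpha> - rcis s \<beta>) / 2"
  \<comment> \<open>Unlike \<open>sgn\<close>, \<open>cis (Arg _)\<close> stays unimodular when
    \<open>P\<close> or \<open>Q\<close> vanishes. The phase \<open>\<kappa>\<close> will be that of
    \<open>Q\<close> relative to \<open>P\<close>.\<close>
  define a b where "a = cis (Arg P)" and "b = cis (Arg Q)"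
  have P: "P = a * cmod P" and Q: "Q = b * cmod Q"
    using rcis_cmod_Arg[of P] rcis_cmod_Arg[of Q]
    by (simp_all add: a_def b_def rcis_def mult.commute)
  have a: "cmod a = 1" by (simp add: a_def)
  show thesis
  proof (rule that[of "cmod P" "cmod Q" a "cnj a * b"])
    have "a * (cmod P + cmod Q * (cnj a * b)) = P + Q" "a * (cmod P - cmod Q * (cnj a * b)) = P - Q"
      using P Q unimodular_mult_cnj(1)[OF a] by algebra+
    then show "rcis r \<alpha> = a * (cmod P + cmod Q * (cnj a * b))"
      "rcis s \<beta> = a * (cmod P - cmod Q * (cnj a * b))"
      by (simp_all add: P_def Q_def field_simps)
    show "cmod P + cmod Q = dual_value r s (\<alpha> - \<beta>)"
      unfolding half_sum_diff_norms[symmetric] P_def Q_def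
      by (simp add: norm_divide field_simps)
  qed (simp_all add: a norm_mult b_def)
qed

section \<open>The three types of partition\<close>

lemma vec4_components:
  fixes p q m n :: "'a::zero"
  obtains v :: "'a ^ 4" where "v $ 1 = p" "v $ 2 = q" "v $ 3 = m" "v $ 4 = n"
proof
  let ?v = "(\<chi> j. if j = 1 then p else if j = 2 then q else if j = 3 then m else n) :: 'a ^ 4"
  show "?v $ 1 = p" "?v $ 2 = q" "?v $ 3 = m" "?v $ 4 = n" by simp_all
qed

lemma is_phase_differenceE:
  assumes "is_phase_difference c \<phi>"
  obtains \<theta> :: "real ^ 4" where "\<forall>j. c $ j = rcis (cmod (c $ j)) (\<theta> $ j)"
    "\<phi> = (\<theta> $ 1 + \<theta> $ 4) - (\<theta> $ 2 + \<theta> $ 3)"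
  using assms unfolding is_phase_difference_def rcis_def cis_conv_exp by metis

lemma rcis_add_angle: "rcis r (\<alpha> + \<delta>) = cis \<delta> * rcis r \<alpha>"
  by (simp add: rcis_def flip: cis_mult)

lemma X_dual_norm_pair_14_23:
  assumes "cmod (c $ 1) = r" "cmod (c $ 4) = r" "cmod (c $ 2) = s" "cmod (c $ 3) = s"
    and "is_phase_difference c \<phi>"
  shows "X_dual_norm c = dual_value r s (\<phi> / 2)"
proof -
  obtain \<theta> where \<theta>: "\<forall>j. c $ j = rcis (cmod (c $ j)) (\<theta> $ j)"
    and \<phi>: "\<phi> = (\<theta> $ 1 + \<theta> $ 4) - (\<theta> $ 2 + \<theta> $ 3)"
    using assms(5) by (rule is_phase_differenceE)
  \<comment> \<open>Splits the arguments into those of \<open>(x, y, y, x)\<close> and the balanced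
    twist \<open>(\<delta>, \<epsilon>, -\<epsilon>, -\<delta>)\<close>.\<close>
  define \<alpha> \<beta> \<delta> \<epsilon> where "\<alpha> = (\<theta> $ 1 + \<theta> $ 4) / 2" and "\<beta> = (\<theta> $ 2 + \<theta> $ 3) / 2"
    and "\<delta> = (\<theta> $ 1 - \<theta> $ 4) / 2" and "\<epsilon> = (\<theta> $ 2 - \<theta> $ 3) / 2"
  have "\<theta> $ 1 = \<alpha> + \<delta>" "\<theta> $ 2 = \<beta> + \<epsilon>" "\<theta> $ 3 = \<beta> + - \<epsilon>" "\<theta> $ 4 = \<alpha> + - \<delta>"
    by (simp_all add: \<alpha>_def \<beta>_def \<delta>_def \<epsilon>_def field_simps)
  then have c: "c $ 1 = cis \<delta> * rcis r \<alpha>" "c $ 2 = cis \<epsilon> * rcis s \<beta>"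
    "c $ 3 = cis (- \<epsilon>) * rcis s \<beta>" "c $ 4 = cis (- \<delta>) * rcis r \<alpha>"
    using \<theta>[rule_format, of 1] \<theta>[rule_format, of 2] \<theta>[rule_format, of 3]
      \<theta>[rule_format, of 4] assms
    by (simp_all only: rcis_add_angle)
  obtain A B a \<kappa> where AB: "A \<ge> 0" "B \<ge> 0" and a: "cmod a = 1" and \<kappa>: "cmod \<kappa> = 1"
    and xy: "rcis r \<alpha> = a * (complex_of_real A + B * \<kappa>)" "rcis s \<beta> = a * (complex_of_real A - B * \<kappa>)"
    and val: "A + B = dual_value r s (\<alpha> - \<beta>)"
    by (rule rcis_pair_decomposition[of r \<alpha> s \<beta>])
  obtain u :: "complex ^ 4" where u: "u $ 1 = cis \<delta> * a" "u $ 2 = cis \<epsilon> * a"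
    "u $ 3 = cis (- \<epsilon>) * a" "u $ 4 = cis (- \<delta>) * a"
    by (rule vec4_components)
  obtain w :: "complex ^ 4" where w: "w $ 1 = \<kappa>" "w $ 2 = - \<kappa>" "w $ 3 = - \<kappa>" "w $ 4 = \<kappa>"
    by (rule vec4_components)
  have "X_dual_norm c = A + B"
  proof (rule X_dual_norm_eqI)
    show "balanced_phases u"
      using a by (simp add: balanced_phases_def forall_4 u norm_mult cis_mult mult_ac
          flip: mult.assoc[of "cis _" "cis _"])
    show "balanced_phases w"
      using \<kappa> by (simp add: balanced_phases_def forall_4 w)
    show "c $ j = u $ j * (complex_of_real A + complex_of_real B * w $ j)" for j
      using exhaust_4[of j] by (auto simp: c u w xy mult.assoc)
    show "cmod ((1 + cnj (w $ 1)) * s + (1 + w $ 4)) + cmod ((1 + cnj (w $ 2)) * s + (1 + w $ 3)) \<le> 4"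
      if "cmod s = 1" for s
      using cmod_add_cmod_le_4_of_real_pair[OF that \<kappa>] by (simp add: w)
  qed (simp_all add: w AB)
  moreover have "\<alpha> - \<beta> = \<phi> / 2" by (simp add: \<alpha>_def \<beta>_def \<phi> field_simps)
  ultimately show ?thesis using val by simp
qed

lemma X_dual_norm_pair_12_34:
  assumes "cmod (c $ 1) = r" "cmod (c $ 2) = r" "cmod (c $ 3) = s" "cmod (c $ 4) = s"
    and "is_phase_difference c \<phi>"
  shows "X_dual_norm c = dual_value r s (\<phi> / 2)"
proof -
  obtain \<theta> where \<theta>: "\<forall>j. c $ j = rcis (cmod (c $ j)) (\<theta> $ j)"
    and \<phi>: "\<phi> = (\<theta> $ 1 + \<theta> $ 4) - (\<theta> $ 2 + \<theta> $ 3)"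
    using assms(5) by (rule is_phase_differenceE)
  \<comment> \<open>Now the shape is \<open>(x, cnj x, y, cnj y)\<close> and the balanced twist is
    \<open>(\<delta>, \<delta>, \<epsilon>, \<epsilon>)\<close>.\<close>
  define \<alpha> \<beta> \<delta> \<epsilon> where "\<alpha> = (\<theta> $ 1 - \<theta> $ 2) / 2" and "\<beta> = (\<theta> $ 3 - \<theta> $ 4) / 2"
    and "\<delta> = (\<theta> $ 1 + \<theta> $ 2) / 2" and "\<epsilon> = (\<theta> $ 3 + \<theta> $ 4) / 2"
  have "\<theta> $ 1 = \<alpha> + \<delta>" "\<theta> $ 2 = - \<alpha> + \<delta>" "\<theta> $ 3 = \<beta> + \<epsilon>" "\<theta> $ 4 = - \<beta> + \<epsilon>"
    by (simp_all add: \<alpha>_def \<beta>_def \<delta>_def \<epsilon>_def field_simps)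
  then have c: "c $ 1 = cis \<delta> * rcis r \<alpha>" "c $ 2 = cis \<delta> * cnj (rcis r \<alpha>)"
    "c $ 3 = cis \<epsilon> * rcis s \<beta>" "c $ 4 = cis \<epsilon> * cnj (rcis s \<beta>)"
    using \<theta>[rule_format, of 1] \<theta>[rule_format, of 2] \<theta>[rule_format, of 3]
      \<theta>[rule_format, of 4] assms
    by (simp_all only: rcis_add_angle) (simp_all add: rcis_def cis_cnj)
  obtain A B a \<kappa> where AB: "A \<ge> 0" "B \<ge> 0" and a: "cmod a = 1" and \<kappa>: "cmod \<kappa> = 1"
    and xy: "rcis r \<alpha> = a * (complex_of_real A + B * \<kappa>)" "rcis s \<beta> = a * (complex_of_real A - B * \<kappa>)"
    and val: "A + B = dual_value r s (\<alpha> - \<beta>)"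
    by (rule rcis_pair_decomposition[of r \<alpha> s \<beta>])
  \<comment> \<open>As \<open>A\<close> and \<open>B\<close> are real, conjugating \<open>x\<close>
    and \<open>y\<close> only conjugates \<open>a\<close> and \<open>\<kappa>\<close>.\<close>
  obtain u :: "complex ^ 4" where u: "u $ 1 = cis \<delta> * a" "u $ 2 = cis \<delta> * cnj a"
    "u $ 3 = cis \<epsilon> * a" "u $ 4 = cis \<epsilon> * cnj a"
    by (rule vec4_components)
  obtain w :: "complex ^ 4" where w: "w $ 1 = \<kappa>" "w $ 2 = cnj \<kappa>" "w $ 3 = - \<kappa>" "w $ 4 = - cnj \<kappa>"
    by (rule vec4_components)
  have "X_dual_norm c = A + B"
  proof (rule X_dual_norm_eqI)
    show "balanced_phases u"
      using a by (simp add: balanced_phases_def forall_4 u norm_mult)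
    show "balanced_phases w"
      using \<kappa> by (simp add: balanced_phases_def forall_4 w)
    show "c $ j = u $ j * (complex_of_real A + complex_of_real B * w $ j)" for j
      using exhaust_4[of j] by (auto simp: c u w xy mult.assoc)
    show "cmod ((1 + cnj (w $ 1)) * s + (1 + w $ 4)) + cmod ((1 + cnj (w $ 2)) * s + (1 + w $ 3)) \<le> 4"
      if "cmod s = 1" for s
      using cmod_add_cmod_le_4_of_conjugate_pair[OF that \<kappa>] by (simp add: w)
  qed (simp_all add: w AB)
  moreover have "\<alpha> - \<beta> = \<phi> / 2" by (simp add: \<alpha>_def \<beta>_def \<phi> field_simps)
  ultimately show ?thesis using val by simp
qed

text \<open>Conjugation followed by rotation by \<open>cis \<sigma>\<close> exchanges the roles of
  \<open>z $ 2\<close> and \<open>z $ 3\<close> in the second absolute value.\<close>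

lemma X_norm_swap_23:
  assumes "w $ 1 = z $ 1" "w $ 2 = z $ 3" "w $ 3 = z $ 2" "w $ 4 = z $ 4"
  shows "X_norm w = X_norm z"
proof -
  have "X_profile w \<sigma> = X_profile z \<sigma>" for \<sigma>
  proof -
    have "z $ 3 * cis \<sigma> + cnj (z $ 2) = cis \<sigma> * cnj (z $ 2 * cis \<sigma> + cnj (z $ 3))"
      by (simp add: algebra_simps unimodular_mult_cnj)
    then have "cmod (z $ 3 * cis \<sigma> + cnj (z $ 2)) = cmod (z $ 2 * cis \<sigma> + cnj (z $ 3))"
      by (simp only: norm_mult norm_cis complex_mod_cnj mult_1)
    then show ?thesis using assms by (simp add: X_profile_cis)
  qed
  then show ?thesis by (simp add: X_norm_def)
qed

lemma X_dual_norm_swap_23: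
  assumes "d $ 1 = c $ 1" "d $ 2 = c $ 3" "d $ 3 = c $ 2" "d $ 4 = c $ 4"
  shows "X_dual_norm d = X_dual_norm c"
proof -
  \<comment> \<open>The swap is an involution, so one inclusion, applied in both directions, gives
    equality.\<close>
  have sub: "{cmod (bilin d z) | z. X_norm z = 1} \<subseteq> {cmod (bilin c z) | z. X_norm z = 1}"
    if dc: "d $ 1 = c $ 1" "d $ 2 = c $ 3" "d $ 3 = c $ 2" "d $ 4 = c $ 4" for c d
  proof safe
    fix z assume "X_norm z = 1"
    obtain w :: "complex ^ 4" where w: "w $ 1 = z $ 1" "w $ 2 = z $ 3" "w $ 3 = z $ 2" "w $ 4 = z $ 4"
      by (rule vec4_components)
    have "X_norm w = 1" using X_norm_swap_23[OF w] \<open>X_norm z = 1\<close> by simp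
    moreover have "bilin d z = bilin c w"
      by (simp add: bilin_def sum_4 dc w)
    ultimately show "\<exists>w. cmod (bilin d z) = cmod (bilin c w) \<and> X_norm w = 1" by auto
  qed
  then show ?thesis
    unfolding X_dual_norm_def by (intro arg_cong[of _ _ Sup] subset_antisym sub) (simp_all add: assms)
qed

text \<open>Swapping coordinates 2 and 3 reduces this to the previous partition; the phase
  difference is symmetric in these two arguments.\<close>

lemma X_dual_norm_pair_13_24:
  assumes "cmod (c $ 1) = r" "cmod (c $ 3) = r" "cmod (c $ 2) = s" "cmod (c $ 4) = s"
    and "is_phase_difference c \<phi>"
  shows "X_dual_norm c = dual_value r s (\<phi> / 2)"
proof -
  obtain d :: "complex ^ 4" where d: "d $ 1 = c $ 1" "d $ 2 = c $ 3" "d $ 3 = c $ 2" "d $ 4 = c $ 4"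
    by (rule vec4_components)
  have "is_phase_difference d \<phi>"
  proof -
    obtain \<theta> where \<theta>: "\<And>j. c $ j = cmod (c $ j) * exp (\<i> * complex_of_real (\<theta> $ j))"
      and \<phi>: "\<phi> = (\<theta> $ 1 + \<theta> $ 4) - (\<theta> $ 2 + \<theta> $ 3)"
      using assms(5) unfolding is_phase_difference_def by metis
    obtain \<eta> :: "real ^ 4" where \<eta>: "\<eta> $ 1 = \<theta> $ 1" "\<eta> $ 2 = \<theta> $ 3" "\<eta> $ 3 = \<theta> $ 2" "\<eta> $ 4 = \<theta> $ 4"
      by (rule vec4_components)
    show ?thesis
      unfolding is_phase_difference_def
      using \<theta>[of 1] \<theta>[of 2] \<theta>[of 3] \<theta>[of 4] \<phi>
      by (intro exI[of _ \<eta>]) (simp add: forall_4 d \<eta>)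
  qed
  then have "X_dual_norm d = dual_value r s (\<phi> / 2)"
    using assms by (intro X_dual_norm_pair_12_34) (simp_all add: d)
  then show ?thesis using X_dual_norm_swap_23[OF d] by simp
qed

lemma X_dual_norm_two_moduli:
  fixes i\<^sub>1 i\<^sub>2 i\<^sub>3 i\<^sub>4 :: 4
  assumes part: "{i\<^sub>1, i\<^sub>2} \<union> {i\<^sub>3, i\<^sub>4} = UNIV" "{i\<^sub>1, i\<^sub>2} \<inter> {i\<^sub>3, i\<^sub>4} = {}"
    and r: "cmod (c $ i\<^sub>1) = r" "cmod (c $ i\<^sub>2) = r" and s: "cmod (c $ i\<^sub>3) = s" "cmod (c $ i\<^sub>4) = s"
    and \<phi>: "is_phase_difference c \<phi>"
  shows "X_dual_norm c = dual_value r s (\<phi> / 2)"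
proof -
  have all: "j = i\<^sub>1 \<or> j = i\<^sub>2 \<or> j = i\<^sub>3 \<or> j = i\<^sub>4" for j using part(1) by blast
  have rj: "cmod (c $ j) = r" if "j \<in> {i\<^sub>1, i\<^sub>2}" for j using that r by auto
  have sj: "cmod (c $ j) = s" if "j \<in> {i\<^sub>3, i\<^sub>4}" for j using that s by auto
  \<comment> \<open>Four indices covering four coordinates are distinct. The even cases exchange
    \<open>r\<close> and \<open>s\<close>, under which \<open>dual_value\<close> is
    symmetric.\<close>
  consider "{i\<^sub>1, i\<^sub>2} = {1, 4}" "{i\<^sub>3, i\<^sub>4} = {2, 3}"
    | "{i\<^sub>1, i\<^sub>2} = {2, 3}" "{i\<^sub>3, i\<^sub>4} = {1, 4}"
    | "{i\<^sub>1, i\<^sub>2} = {1, 2}" "{i\<^sub>3, i\<^sub>4} = {3, 4}"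
    | "{i\<^sub>1, i\<^sub>2} = {3, 4}" "{i\<^sub>3, i\<^sub>4} = {1, 2}"
    | "{i\<^sub>1, i\<^sub>2} = {1, 3}" "{i\<^sub>3, i\<^sub>4} = {2, 4}"
    | "{i\<^sub>1, i\<^sub>2} = {2, 4}" "{i\<^sub>3, i\<^sub>4} = {1, 3}"
    using all[of 1] all[of 2] all[of 3] all[of 4]
    by (elim disjE) (simp_all add: insert_commute)
  then show ?thesis
  proof cases
    case 1
    then show ?thesis using rj sj \<phi> by (intro X_dual_norm_pair_14_23) auto
  next
    case 2
    then have "X_dual_norm c = dual_value s r (\<phi> / 2)"
      using rj sj \<phi> by (intro X_dual_norm_pair_14_23) auto
    then show ?thesis by (simp add: dual_value_commute)
  next
    case 3
    then show ?thesis using rj sj \<phi> by (intro X_dual_norm_pair_12_34) auto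
  next
    case 4
    then have "X_dual_norm c = dual_value s r (\<phi> / 2)"
      using rj sj \<phi> by (intro X_dual_norm_pair_12_34) auto
    then show ?thesis by (simp add: dual_value_commute)
  next
    case 5
    then show ?thesis using rj sj \<phi> by (intro X_dual_norm_pair_13_24) auto
  next
    case 6
    then have "X_dual_norm c = dual_value s r (\<phi> / 2)"
      using rj sj \<phi> by (intro X_dual_norm_pair_13_24) auto
    then show ?thesis by (simp add: dual_value_commute)
  qed
qed

section \<open>From the eigenvalue to the formula in \<open>t\<^sub>0\<close>\<close>

text \<open>The left side is the Rayleigh quotient at \<open>(t, 1)\<close>, and \<open>t\<close> is
  chosen to satisfy the second row of the eigenvector equation for \<open>l\<close>.\<close>

lemma largest_eigenvalue_eq_rayleigh:
  fixes r s k :: real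
  assumes "r * s * k > 0"
  defines "D \<equiv> sqrt ((r\<^sup>2 - s\<^sup>2)\<^sup>2 + (2 * r * s * k)\<^sup>2)"
  defines "t \<equiv> (r\<^sup>2 - s\<^sup>2 + D) / (2 * r * s * k)"
  shows "(r\<^sup>2 * t\<^sup>2 + 2 * r * s * t * k + s\<^sup>2) / (t\<^sup>2 + 1) = (r\<^sup>2 + s\<^sup>2 + D) / 2"
proof -
  define l where "l = (r\<^sup>2 + s\<^sup>2 + D) / 2"
  define m where "m = r * s * k"
  have m: "m \<noteq> 0" using assms(1) by (auto simp: m_def)
  have D2: "D\<^sup>2 = (r\<^sup>2 - s\<^sup>2)\<^sup>2 + (2 * m)\<^sup>2"
    unfolding D_def m_def by (simp add: mult.assoc)
  have t: "m * t = l - s\<^sup>2"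
    using m by (simp add: t_def l_def m_def field_simps)
  have "(l - r\<^sup>2) * (l - s\<^sup>2) = m\<^sup>2"
    using D2 unfolding l_def by (simp add: field_simps power2_eq_square)
  \<comment> \<open>The first row, multiplied by \<open>m\<close>, is the characteristic
    equation.\<close>
  then have "m * ((l - r\<^sup>2) * t) = m * m"
    using t by algebra
  then have "(l - r\<^sup>2) * t = m" using m by simp
  with t have "r\<^sup>2 * t\<^sup>2 + 2 * m * t + s\<^sup>2 = l * (t\<^sup>2 + 1)" by algebra
  moreover have "t\<^sup>2 + 1 \<noteq> 0" by (metis add_nonneg_pos less_irrefl zero_le_power2 zero_less_one)
  ultimately show ?thesis
    unfolding l_def[symmetric] m_def by (simp add: divide_eq_eq mult_ac)
qed

lemma rcong_2pi_0_iff_sin_half: "[\<phi> = 0] (rmod (2 * pi)) \<longleftrightarrow> sin (\<phi> / 2) = 0"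
proof -
  have "[\<phi> = 0] (rmod (2 * pi)) \<longleftrightarrow> cos \<phi> = 1 \<and> sin \<phi> = 0"
    by (simp add: cis_eq_iff[symmetric] complex_eq_iff)
  also have "\<dots> \<longleftrightarrow> sin (\<phi> / 2) = 0"
    using cos_double_sin[of "\<phi> / 2"] sin_double[of "\<phi> / 2"] by auto
  finally show ?thesis .
qed

theorem theorem4p5:
  fixes c :: "complex ^ 4" and i\<^sub>1 i\<^sub>2 i\<^sub>3 i\<^sub>4 :: 4 and r s \<phi> :: real
  assumes "{i\<^sub>1, i\<^sub>2} \<union> {i\<^sub>3, i\<^sub>4} = UNIV" and "{i\<^sub>1, i\<^sub>2} \<inter> {i\<^sub>3, i\<^sub>4} = {}"
    and "cmod (c $ i\<^sub>1) = r" and "cmod (c $ i\<^sub>2) = r"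
    and "cmod (c $ i\<^sub>3) = s" and "cmod (c $ i\<^sub>4) = s"
    and "r \<noteq> 0" and "s \<noteq> 0"
    and "is_phase_difference c \<phi>"
  shows "(\<not> [\<phi> = 0] (rmod (2 * pi)) \<longrightarrow>
            (let t\<^sub>0 = (r\<^sup>2 - s\<^sup>2 + sqrt ((r\<^sup>2 - s\<^sup>2)\<^sup>2 + (2 * r * s * sin (\<phi> / 2))\<^sup>2))
                        / (2 * r * s * \<bar>sin (\<phi> / 2)\<bar>)
             in X_dual_norm c =
                  sqrt ((r\<^sup>2 * t\<^sub>0\<^sup>2 + 2 * r * s * t\<^sub>0 * \<bar>sin (\<phi> / 2)\<bar> + s\<^sup>2) / (t\<^sub>0\<^sup>2 + 1))))
       \<and> ([\<phi> = 0] (rmod (2 * pi)) \<longrightarrow> X_dual_norm c = max r s)"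
proof -
  have pos: "r > 0" "s > 0"
    using assms(3,5,7,8) by auto
  have norm: "X_dual_norm c = dual_value r s (\<phi> / 2)"
    using assms by (intro X_dual_norm_two_moduli)
  show ?thesis
  proof (intro conjI impI)
    assume "\<not> [\<phi> = 0] (rmod (2 * pi))"
    then have "r * s * \<bar>sin (\<phi> / 2)\<bar> > 0"
      using pos by (simp add: rcong_2pi_0_iff_sin_half)
    \<comment> \<open>Reconciles the signed sine under the inner root with
      \<open>k = \<bar>sin (\<phi> / 2)\<bar>\<close>.\<close>
    moreover have "(2 * r * s * \<bar>sin (\<phi> / 2)\<bar>)\<^sup>2 = (2 * r * s * sin (\<phi> / 2))\<^sup>2"
      by (simp add: power_mult_distrib)
    ultimately show "let t\<^sub>0 = (r\<^sup>2 - s\<^sup>2 + sqrt ((r\<^sup>2 - s\<^sup>2)\<^sup>2 + (2 * r * s * sin (\<phi> / 2))\<^sup>2))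
                        / (2 * r * s * \<bar>sin (\<phi> / 2)\<bar>)
             in X_dual_norm c =
                  sqrt ((r\<^sup>2 * t\<^sub>0\<^sup>2 + 2 * r * s * t\<^sub>0 * \<bar>sin (\<phi> / 2)\<bar> + s\<^sup>2) / (t\<^sub>0\<^sup>2 + 1))"
      using largest_eigenvalue_eq_rayleigh[of r s "\<bar>sin (\<phi> / 2)\<bar>"]
      by (simp only: Let_def norm dual_value_def)
  next
    assume "[\<phi> = 0] (rmod (2 * pi))"
    then have "dual_value r s (\<phi> / 2) = sqrt ((r\<^sup>2 + s\<^sup>2 + \<bar>r\<^sup>2 - s\<^sup>2\<bar>) / 2)"
      by (simp add: rcong_2pi_0_iff_sin_half dual_value_def)
    \<comment> \<open>With zero sine the matrix is diagonal, so its larger eigenvalue is the larger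
      of the squared moduli.\<close>
    also have "(r\<^sup>2 + s\<^sup>2 + \<bar>r\<^sup>2 - s\<^sup>2\<bar>) / 2 = (max r s)\<^sup>2"
      using pos power_mono[of r s 2] power_mono[of s r 2] by (auto simp: max_def)
    finally show "X_dual_norm c = max r s" using norm pos by simp
  qed
qed

end
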